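(* Let $k$ be a commutative ring, let $R$ be a $k$-algebra with identity, and let $C$ be a commutative $R$-algebra with $\mathrm{Ann}(C)=0$ or $C^2=C$. Let $A_0=\mathcal{M}(C)$ be the algebra of multipliers of $C$ and let $A_1=C\rtimes\mathcal{M}(C)$. Define $$s(x,f)=f,\qquad t(x,f)=M_x\cdot f,\qquad e(f)=(0,f),$$ where $(M_x\cdot f)(u)=xu+f(u)$ for $u\in C$; define vertical composition by $$(x,f)\circ(x',M_x\cdot f)=(x'+x,f),$$ and define $\bullet$ to be composition of multipliers on $A_0$ and $$(x,f)\bullet(y,f')=\big(f'(x)+f(y)+xy,\;f'f\big)$$ on $A_1$. Then $(A_0,A_1,s,t,e,\circ,\bullet)$ is a $2$-algebra.
   Context: $R$ is commutative. $C$ need not have an identity. $\mathrm{Ann}(C)=\{c\in C: cx=0 \text{ for all } x\in C\}$, and $C^2$ is the ideal spanned by all products $xy$ with $x,y\in C$. A multiplier of $C$ is an $R$-linear map $\lambda:C\to C$ with $\lambda(cc')=\lambda(c)c'$ for all $c,c'\in C$. $\mathcal{M}(C)$ is the $R$-algebra of all multipliers, with pointwise addition and with composition as multiplication. $C\rtimes\mathcal{M}(C)$ is the module $C\times\mathcal{M}(C)$ with componentwise addition and scalar multiplication, and with multiplication $(x,f)(x',f')=(f(x')+f'(x)+x'x,\,f'f)$. A $2$-module is an internal category in the category of $k$-modules: modules $M_0$ and $M_1$, and $k$-linear maps $s,t:M_1\to M_0$, $e:M_0\to M_1$ and $\circ: M_1\times_{M_0}M_1=\{(a,b): t(a)=s(b)\}\to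 M_1$, $(a,b)\mapsto a\circ b$, such that $se=te=\mathrm{id}_{M_0}$, $s(a\circ b)=s(a)$, $t(a\circ b)=t(b)$, $\circ$ is associative, and $e(s(a))\circ a=a=a\circ e(t(a))$ for all $a\in M_1$. A $2$-algebra (commutative strict $2$-algebra) $(A_0,A_1,s,t,e,\circ,\bullet)$ is a $2$-module $A=(A_0,A_1,s,t,e,\circ)$ with a functor $\bullet:A\times A\to A$, $k$-bilinear on objects and on morphisms, which is strictly associative, commutative and unital with an identity object $1\in A_0$ (identity on morphisms $e(1)$). Functoriality means that $s,t,e$ are compatible with $\bullet$ and that the interchange law $(f_1\bullet g_1)\circ(f_2\bullet g_2)=(f_1\circ f_2)\bullet(g_1\circ g_2)$ holds whenever $f_1\circ f_2$ and $g_1\circ g_2$ are defined. *)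

theory Defs
  imports "HOL-Algebra.Module" "HOL-Library.FuncSet"
begin

subsection \<open>Modules and linear maps\<close>

definition linear_maps ::
  "('k, 'i) ring_scheme \<Rightarrow> ('k, 'a, 'm) module_scheme \<Rightarrow> ('k, 'b, 'n) module_scheme \<Rightarrow> ('a \<Rightarrow> 'b) set"
  where "linear_maps k M N =
    {h \<in> carrier M \<rightarrow> carrier N.
      (\<forall>x \<in> carrier M. \<forall>y \<in> carrier M. h (x \<oplus>\<^bsub>M\<^esub> y) = h x \<oplus>\<^bsub>N\<^esub> h y) \<and>
      (\<forall>a \<in> carrier k. \<forall>x \<in> carrier M. h (a \<odot>\<^bsub>M\<^esub> x) = a \<odot>\<^bsub>N\<^esub> h x)}"

definition bilinear_op ::
  "('k, 'i) ring_scheme \<Rightarrow> ('k, 'a, 'm) module_scheme \<Rightarrow> ('a \<Rightarrow> 'a \<Rightarrow> 'a) \<Rightarrow> bool"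
  where "bilinear_op k M f \<longleftrightarrow>
    (\<forall>y \<in> carrier M. (\<lambda>x. f x y) \<in> linear_maps k M M) \<and>
    (\<forall>x \<in> carrier M. (\<lambda>y. f x y) \<in> linear_maps k M M)"

definition module_prod ::
  "('k, 'a, 'm) module_scheme \<Rightarrow> ('k, 'b, 'n) module_scheme \<Rightarrow> ('k, 'a \<times> 'b) module"
  where "module_prod M N =
    \<lparr>carrier = carrier M \<times> carrier N,
     mult = (\<lambda>(x, u) (y, v). (x \<otimes>\<^bsub>M\<^esub> y, u \<otimes>\<^bsub>N\<^esub> v)),
     one = (\<one>\<^bsub>M\<^esub>, \<one>\<^bsub>N\<^esub>),
     zero = (\<zero>\<^bsub>M\<^esub>, \<zero>\<^bsub>N\<^esub>),
     add = (\<lambda>(x, u) (y, v). (x \<oplus>\<^bsub>M\<^esub> y, u \<oplus>\<^bsub>N\<^esub> v)),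
     smult = (\<lambda>a (x, u). (a \<odot>\<^bsub>M\<^esub> x, a \<odot>\<^bsub>N\<^esub> u))\<rparr>"

text \<open>For a \<open>k\<close>-algebra \<open>R\<close> with identity, the \<open>R\<close>-module \<open>M\<close> regarded as a \<open>k\<close>-module
  along \<open>a \<mapsto> a \<cdot> 1\<close>.\<close>

definition restrict_scalars ::
  "('k, 'r, 'm) module_scheme \<Rightarrow> ('r, 'a, 'n) module_scheme \<Rightarrow> ('k, 'a) module"
  where "restrict_scalars R M =
    \<lparr>carrier = carrier M, mult = mult M, one = one M, zero = zero M, add = add M,
     smult = (\<lambda>a x. (a \<odot>\<^bsub>R\<^esub> \<one>\<^bsub>R\<^esub>) \<odot>\<^bsub>M\<^esub> x)\<rparr>"


subsection \<open>Commutative algebras without identity and their multipliers\<close>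

text \<open>The field \<open>one\<close> of the record \<open>C\<close> is unconstrained: \<open>C\<close> need not have an identity.\<close>

locale comm_nonunital_algebra = module R C
  for R :: "('r, 'i) ring_scheme" (structure) and C :: "('r, 'c, 'm) module_scheme" (structure) +
  assumes mult_closed: "\<lbrakk>x \<in> carrier C; y \<in> carrier C\<rbrakk> \<Longrightarrow> x \<otimes>\<^bsub>C\<^esub> y \<in> carrier C"
    and mult_assoc: "\<lbrakk>x \<in> carrier C; y \<in> carrier C; z \<in> carrier C\<rbrakk>
      \<Longrightarrow> (x \<otimes>\<^bsub>C\<^esub> y) \<otimes>\<^bsub>C\<^esub> z = x \<otimes>\<^bsub>C\<^esub> (y \<otimes>\<^bsub>C\<^esub> z)"
    and mult_comm: "\<lbrakk>x \<in> carrier C; y \<in> carrier C\<rbrakk> \<Longrightarrow> x \<otimes>\<^bsub>C\<^esub> y = y \<otimes>\<^bsub>C\<^esub> x"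
    and mult_distr: "\<lbrakk>x \<in> carrier C; y \<in> carrier C; z \<in> carrier C\<rbrakk>
      \<Longrightarrow> (x \<oplus>\<^bsub>C\<^esub> y) \<otimes>\<^bsub>C\<^esub> z = x \<otimes>\<^bsub>C\<^esub> z \<oplus>\<^bsub>C\<^esub> y \<otimes>\<^bsub>C\<^esub> z"
    and smult_mult: "\<lbrakk>a \<in> carrier R; x \<in> carrier C; y \<in> carrier C\<rbrakk>
      \<Longrightarrow> (a \<odot>\<^bsub>C\<^esub> x) \<otimes>\<^bsub>C\<^esub> y = a \<odot>\<^bsub>C\<^esub> (x \<otimes>\<^bsub>C\<^esub> y)"

definition Ann :: "('r, 'c, 'm) module_scheme \<Rightarrow> 'c set"
  where "Ann C = {c \<in> carrier C. \<forall>x \<in> carrier C. c \<otimes>\<^bsub>C\<^esub> x = \<zero>\<^bsub>C\<^esub>}"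

definition algebra_ideal ::
  "'c set \<Rightarrow> ('r, 'i) ring_scheme \<Rightarrow> ('r, 'c, 'm) module_scheme \<Rightarrow> bool"
  where "algebra_ideal I R C \<longleftrightarrow>
    submodule I R C \<and> (\<forall>x \<in> I. \<forall>y \<in> carrier C. x \<otimes>\<^bsub>C\<^esub> y \<in> I \<and> y \<otimes>\<^bsub>C\<^esub> x \<in> I)"

definition ideal_square ::
  "('r, 'i) ring_scheme \<Rightarrow> ('r, 'c, 'm) module_scheme \<Rightarrow> 'c set"
  where "ideal_square R C =
    \<Inter> {I. algebra_ideal I R C \<and> (\<forall>x \<in> carrier C. \<forall>y \<in> carrier C. x \<otimes>\<^bsub>C\<^esub> y \<in> I)}"

text \<open>Multipliers are functions on the set \<open>carrier C\<close>; they are taken to be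
  \<open>undefined\<close> off \<open>carrier C\<close>, so that equality of multipliers is equality as functions on \<open>C\<close>.\<close>

definition multipliers ::
  "('r, 'i) ring_scheme \<Rightarrow> ('r, 'c, 'm) module_scheme \<Rightarrow> ('c \<Rightarrow> 'c) set"
  where "multipliers R C =
    {f \<in> linear_maps R C C \<inter> extensional (carrier C).
      \<forall>c \<in> carrier C. \<forall>c' \<in> carrier C. f (c \<otimes>\<^bsub>C\<^esub> c') = f c \<otimes>\<^bsub>C\<^esub> c'}"

definition multiplier_algebra ::
  "('r, 'i) ring_scheme \<Rightarrow> ('r, 'c, 'm) module_scheme \<Rightarrow> ('r, 'c \<Rightarrow> 'c) module"
  where "multiplier_algebra R C =
    \<lparr>carrier = multipliers R C,
     mult = (\<lambda>f g. compose (carrier C) f g),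
     one = (\<lambda>u \<in> carrier C. u),
     zero = (\<lambda>u \<in> carrier C. \<zero>\<^bsub>C\<^esub>),
     add = (\<lambda>f g. \<lambda>u \<in> carrier C. f u \<oplus>\<^bsub>C\<^esub> g u),
     smult = (\<lambda>a f. \<lambda>u \<in> carrier C. a \<odot>\<^bsub>C\<^esub> f u)\<rparr>"

definition semidirect_multiplier ::
  "('r, 'i) ring_scheme \<Rightarrow> ('r, 'c, 'm) module_scheme \<Rightarrow> ('r, 'c \<times> ('c \<Rightarrow> 'c)) module"
  where "semidirect_multiplier R C =
    (module_prod C (multiplier_algebra R C))
      \<lparr>mult := (\<lambda>(x, f) (x', f').
          (f x' \<oplus>\<^bsub>C\<^esub> f' x \<oplus>\<^bsub>C\<^esub> x' \<otimes>\<^bsub>C\<^esub> x, f' \<otimes>\<^bsub>multiplier_algebra R C\<^esub> f)),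
       one := (\<zero>\<^bsub>C\<^esub>, \<one>\<^bsub>multiplier_algebra R C\<^esub>)\<rparr>"

definition mult_act :: "('r, 'c, 'm) module_scheme \<Rightarrow> 'c \<Rightarrow> ('c \<Rightarrow> 'c) \<Rightarrow> ('c \<Rightarrow> 'c)"
  where "mult_act C x f = (\<lambda>u \<in> carrier C. x \<otimes>\<^bsub>C\<^esub> u \<oplus>\<^bsub>C\<^esub> f u)"


subsection \<open>2-modules and 2-algebras\<close>

definition composable_pairs ::
  "('k, 'b, 'n) module_scheme \<Rightarrow> ('b \<Rightarrow> 'a) \<Rightarrow> ('b \<Rightarrow> 'a) \<Rightarrow> ('k, 'b \<times> 'b) module"
  where "composable_pairs M1 s t =
    (module_prod M1 M1)\<lparr>carrier := {(a, b). a \<in> carrier M1 \<and> b \<in> carrier M1 \<and> t a = s b}\<rparr>"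

text \<open>Composition is in diagrammatic order, and the total function \<open>comp\<close> is only constrained
  on composable pairs. Of the records \<open>M0\<close> and \<open>M1\<close> only the module structure is used.\<close>

locale two_module =
  M0: module k M0 + M1: module k M1
  for k :: "('k, 'i) ring_scheme"
    and M0 :: "('k, 'a, 'm) module_scheme" and M1 :: "('k, 'b, 'n) module_scheme"
    and s :: "'b \<Rightarrow> 'a" and t :: "'b \<Rightarrow> 'a" and e :: "'a \<Rightarrow> 'b"
    and comp :: "'b \<times> 'b \<Rightarrow> 'b" +
  assumes source_linear: "s \<in> linear_maps k M1 M0"
    and target_linear: "t \<in> linear_maps k M1 M0"
    and ident_linear: "e \<in> linear_maps k M0 M1"
    and comp_linear: "comp \<in> linear_maps k (composable_pairs M1 s t) M1"
    and source_ident: "x \<in> carrier M0 \<Longrightarrow> s (e x) = x"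
    and target_ident: "x \<in> carrier M0 \<Longrightarrow> t (e x) = x"
    and source_comp: "\<lbrakk>a \<in> carrier M1; b \<in> carrier M1; t a = s b\<rbrakk> \<Longrightarrow> s (comp (a, b)) = s a"
    and target_comp: "\<lbrakk>a \<in> carrier M1; b \<in> carrier M1; t a = s b\<rbrakk> \<Longrightarrow> t (comp (a, b)) = t b"
    and comp_assoc:
      "\<lbrakk>a \<in> carrier M1; b \<in> carrier M1; c \<in> carrier M1; t a = s b; t b = s c\<rbrakk>
        \<Longrightarrow> comp (comp (a, b), c) = comp (a, comp (b, c))"
    and ident_comp: "a \<in> carrier M1 \<Longrightarrow> comp (e (s a), a) = a"
    and comp_ident: "a \<in> carrier M1 \<Longrightarrow> comp (a, e (t a)) = a"

text \<open>The functor has an object part \<open>bul0\<close> and a morphism part \<open>bul1\<close>; that they take values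
  in \<open>A0\<close> and \<open>A1\<close> is part of bilinearity.\<close>

locale two_algebra = two_module k A0 A1 s t e comp
  for k :: "('k, 'i) ring_scheme"
    and A0 :: "('k, 'a, 'm) module_scheme" and A1 :: "('k, 'b, 'n) module_scheme"
    and s :: "'b \<Rightarrow> 'a" and t :: "'b \<Rightarrow> 'a" and e :: "'a \<Rightarrow> 'b"
    and comp :: "'b \<times> 'b \<Rightarrow> 'b"
    and bul0 :: "'a \<Rightarrow> 'a \<Rightarrow> 'a" and bul1 :: "'b \<Rightarrow> 'b \<Rightarrow> 'b" +
  assumes bul0_bilinear: "bilinear_op k A0 bul0"
    and bul1_bilinear: "bilinear_op k A1 bul1"
    and source_bul: "\<lbrakk>f \<in> carrier A1; g \<in> carrier A1\<rbrakk> \<Longrightarrow> s (bul1 f g) = bul0 (s f) (s g)"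
    and target_bul: "\<lbrakk>f \<in> carrier A1; g \<in> carrier A1\<rbrakk> \<Longrightarrow> t (bul1 f g) = bul0 (t f) (t g)"
    and ident_bul: "\<lbrakk>x \<in> carrier A0; y \<in> carrier A0\<rbrakk> \<Longrightarrow> e (bul0 x y) = bul1 (e x) (e y)"
    and interchange:
      "\<lbrakk>f1 \<in> carrier A1; f2 \<in> carrier A1; g1 \<in> carrier A1; g2 \<in> carrier A1;
        t f1 = s f2; t g1 = s g2\<rbrakk>
        \<Longrightarrow> comp (bul1 f1 g1, bul1 f2 g2) = bul1 (comp (f1, f2)) (comp (g1, g2))"
    and bul0_assoc: "\<lbrakk>x \<in> carrier A0; y \<in> carrier A0; z \<in> carrier A0\<rbrakk>
        \<Longrightarrow> bul0 (bul0 x y) z = bul0 x (bul0 y z)"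
    and bul1_assoc: "\<lbrakk>f \<in> carrier A1; g \<in> carrier A1; h \<in> carrier A1\<rbrakk>
        \<Longrightarrow> bul1 (bul1 f g) h = bul1 f (bul1 g h)"
    and bul0_comm: "\<lbrakk>x \<in> carrier A0; y \<in> carrier A0\<rbrakk> \<Longrightarrow> bul0 x y = bul0 y x"
    and bul1_comm: "\<lbrakk>f \<in> carrier A1; g \<in> carrier A1\<rbrakk> \<Longrightarrow> bul1 f g = bul1 g f"
    and unital: "\<exists>u \<in> carrier A0.
        (\<forall>x \<in> carrier A0. bul0 u x = x \<and> bul0 x u = x) \<and>
        (\<forall>f \<in> carrier A1. bul1 (e u) f = f \<and> bul1 f (e u) = f)"

end

theory Submission
  imports Defs
begin

text \<open>The hypothesis on \<open>C\<close> serves only to make multipliers commute. In general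
  \<open>f (g (x y)) = g x \<cdot> f y = g (f (x y))\<close>, so the commutator of \<open>f\<close> and \<open>g\<close> kills \<open>C\<^sup>2\<close>;
  since it is itself a multiplier, its values annihilate \<open>C\<close>. All axioms can then be verified
  over \<open>R\<close>, because a 2-algebra over \<open>R\<close> remains one under restriction of scalars to \<open>k\<close>.\<close>

section \<open>Restriction of scalars along \<open>k \<rightarrow> R\<close>\<close>

lemma restrict_scalars_simps [simp]:
  "carrier (restrict_scalars R M) = carrier M"
  "add (restrict_scalars R M) = add M"
  "zero (restrict_scalars R M) = zero M"
  "smult (restrict_scalars R M) = (\<lambda>a x. (a \<odot>\<^bsub>R\<^esub> \<one>\<^bsub>R\<^esub>) \<odot>\<^bsub>M\<^esub> x)"
  by (simp_all add: restrict_scalars_def)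

text \<open>The map sending \<open>a\<close> to \<open>a \<odot> \<one>\<close> is a ring
  homomorphism from \<open>k\<close> to \<open>R\<close>; its multiplicativity, the local fact
  \<open>mult\<close>, gives the associativity law for the new scalar action.\<close>

lemma module_restrict_scalars:
  assumes "algebra k R" and "module R M"
  shows "module k (restrict_scalars R M)"
proof -
  interpret R: algebra k R by fact
  interpret M: module R M by fact
  have one: "a \<odot>\<^bsub>R\<^esub> \<one>\<^bsub>R\<^esub> \<in> carrier R" if "a \<in> carrier k" for a
    using that by simp
  have mult: "(a \<otimes>\<^bsub>k\<^esub> b) \<odot>\<^bsub>R\<^esub> \<one>\<^bsub>R\<^esub> = (a \<odot>\<^bsub>R\<^esub> \<one>\<^bsub>R\<^esub>) \<otimes>\<^bsub>R\<^esub> (b \<odot>\<^bsub>R\<^esub> \<one>\<^bsub>R\<^esub>)"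
    if "a \<in> carrier k" "b \<in> carrier k" for a b
    using that by (simp add: R.smult_assoc1 R.smult_assoc2)
  show ?thesis
  proof (rule moduleI)
    show "cring k"
      by (rule R.R.is_cring)
    show "abelian_group (restrict_scalars R M)"
    proof (rule abelian_groupI)
      show "\<exists>y \<in> carrier (restrict_scalars R M).
          y \<oplus>\<^bsub>restrict_scalars R M\<^esub> x = \<zero>\<^bsub>restrict_scalars R M\<^esub>"
        if "x \<in> carrier (restrict_scalars R M)" for x
        using that by (intro bexI [where x = "\<ominus>\<^bsub>M\<^esub> x"]) (simp_all add: M.l_neg)
    qed (simp_all add: M.a_ac)
  qed (simp_all add: one mult R.smult_l_distr M.smult_l_distr M.smult_r_distr M.smult_assoc1)
qed

lemma linear_maps_restrict_scalars:
  assumes "algebra k R" and "h \<in> linear_maps R M N"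
  shows "h \<in> linear_maps k (restrict_scalars R M) (restrict_scalars R N)"
proof -
  interpret R: algebra k R by fact
  show ?thesis using assms(2) by (auto simp: linear_maps_def)
qed

lemma bilinear_op_restrict_scalars:
  assumes "algebra k R" and "bilinear_op R M f"
  shows "bilinear_op k (restrict_scalars R M) f"
  using assms linear_maps_restrict_scalars [OF assms(1)]
  by (auto simp: bilinear_op_def)

text \<open>Scalars act componentwise on pairs, so the two records coincide literally. This
  identification carries the linearity of composition over to \<open>k\<close>.\<close>

lemma composable_pairs_restrict_scalars:
  "composable_pairs (restrict_scalars R M) s t = restrict_scalars R (composable_pairs M s t)"
  by (auto simp: composable_pairs_def restrict_scalars_def module_prod_def fun_eq_iff)

text \<open>Only the linearity and bilinearity axioms involve scalars, and they pass to
  \<open>k\<close> because each \<open>a \<odot> \<one>\<close> is a scalar of \<open>R\<close>. The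
  other axioms speak of carriers and structure maps, which stay the same.\<close>

lemma two_algebra_restrict_scalars:
  assumes "algebra k R" and "two_algebra R A0 A1 s t e cmp bul0 bul1"
  shows "two_algebra k (restrict_scalars R A0) (restrict_scalars R A1) s t e cmp bul0 bul1"
proof -
  interpret A: two_algebra R A0 A1 s t e cmp bul0 bul1 by fact
  note lin = linear_maps_restrict_scalars [OF assms(1)]
  note bil = bilinear_op_restrict_scalars [OF assms(1)]
  note modu = module_restrict_scalars [OF assms(1)]
  interpret A0: module k "restrict_scalars R A0" by (rule modu) (rule A.M0.module_axioms)
  interpret A1: module k "restrict_scalars R A1" by (rule modu) (rule A.M1.module_axioms)
  show ?thesis
    apply unfold_locales
    subgoal using A.source_linear by (rule lin)
    subgoal using A.target_linear by (rule lin)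
    subgoal using A.ident_linear by (rule lin)
    subgoal unfolding composable_pairs_restrict_scalars using A.comp_linear by (rule lin)
    subgoal by (simp add: A.source_ident)
    subgoal by (simp add: A.target_ident)
    subgoal by (simp add: A.source_comp)
    subgoal by (simp add: A.target_comp)
    subgoal by (simp add: A.comp_assoc)
    subgoal by (simp add: A.ident_comp)
    subgoal by (simp add: A.comp_ident)
    subgoal using A.bul0_bilinear by (rule bil)
    subgoal using A.bul1_bilinear by (rule bil)
    subgoal by (simp add: A.source_bul)
    subgoal by (simp add: A.target_bul)
    subgoal by (simp add: A.ident_bul)
    subgoal by (simp add: A.interchange)
    subgoal by (simp add: A.bul0_assoc)
    subgoal by (simp add: A.bul1_assoc)
    subgoal by (simp add: A.bul0_comm)
    subgoal by (simp add: A.bul1_comm)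
    subgoal using A.unital by simp
    done
qed

section \<open>Unfolding the records of multipliers and of the semidirect product\<close>

lemma multiplier_algebra_simps [simp]:
  "carrier (multiplier_algebra R C) = multipliers R C"
  "f \<oplus>\<^bsub>multiplier_algebra R C\<^esub> g = (\<lambda>u \<in> carrier C. f u \<oplus>\<^bsub>C\<^esub> g u)"
  "\<zero>\<^bsub>multiplier_algebra R C\<^esub> = (\<lambda>u \<in> carrier C. \<zero>\<^bsub>C\<^esub>)"
  "a \<odot>\<^bsub>multiplier_algebra R C\<^esub> f = (\<lambda>u \<in> carrier C. a \<odot>\<^bsub>C\<^esub> f u)"
  by (simp_all add: multiplier_algebra_def)

lemma semidirect_multiplier_simps [simp]:
  "carrier (semidirect_multiplier R C) = carrier C \<times> multipliers R C"
  "(x, f) \<oplus>\<^bsub>semidirect_multiplier R C\<^esub> (y, g) = (x \<oplus>\<^bsub>C\<^esub> y, f \<oplus>\<^bsub>multiplier_algebra R C\<^esub> g)"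
  "\<zero>\<^bsub>semidirect_multiplier R C\<^esub> = (\<zero>\<^bsub>C\<^esub>, \<zero>\<^bsub>multiplier_algebra R C\<^esub>)"
  "a \<odot>\<^bsub>semidirect_multiplier R C\<^esub> (x, f) = (a \<odot>\<^bsub>C\<^esub> x, a \<odot>\<^bsub>multiplier_algebra R C\<^esub> f)"
  by (simp_all add: semidirect_multiplier_def module_prod_def)

section \<open>Calculation rules for the algebra and its multipliers\<close>

context comm_nonunital_algebra
begin

lemma mult_rdistr:
  "\<lbrakk>x \<in> carrier C; y \<in> carrier C; z \<in> carrier C\<rbrakk>
    \<Longrightarrow> z \<otimes>\<^bsub>C\<^esub> (x \<oplus>\<^bsub>C\<^esub> y) = z \<otimes>\<^bsub>C\<^esub> x \<oplus>\<^bsub>C\<^esub> z \<otimes>\<^bsub>C\<^esub> y"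
  by (metis mult_comm mult_distr M.a_closed)

lemma mult_smult:
  "\<lbrakk>a \<in> carrier R; x \<in> carrier C; y \<in> carrier C\<rbrakk>
    \<Longrightarrow> x \<otimes>\<^bsub>C\<^esub> (a \<odot>\<^bsub>C\<^esub> y) = a \<odot>\<^bsub>C\<^esub> (x \<otimes>\<^bsub>C\<^esub> y)"
  by (metis mult_comm smult_mult smult_closed)

text \<open>Zero is written as the scalar zero times \<open>x\<close>, and the scalar is pulled out
  of the product.\<close>

lemma mult_zero: "x \<in> carrier C \<Longrightarrow> x \<otimes>\<^bsub>C\<^esub> \<zero>\<^bsub>C\<^esub> = \<zero>\<^bsub>C\<^esub>"
  using mult_smult [of "\<zero>\<^bsub>R\<^esub>" x x] mult_closed by simp

lemma zero_mult: "x \<in> carrier C \<Longrightarrow> \<zero>\<^bsub>C\<^esub> \<otimes>\<^bsub>C\<^esub> x = \<zero>\<^bsub>C\<^esub>"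
  using smult_mult [of "\<zero>\<^bsub>R\<^esub>" x x] mult_closed by simp

lemma multipliersI:
  assumes "\<And>x. x \<in> carrier C \<Longrightarrow> f x \<in> carrier C"
    and "\<And>x y. \<lbrakk>x \<in> carrier C; y \<in> carrier C\<rbrakk> \<Longrightarrow> f (x \<oplus>\<^bsub>C\<^esub> y) = f x \<oplus>\<^bsub>C\<^esub> f y"
    and "\<And>a x. \<lbrakk>a \<in> carrier R; x \<in> carrier C\<rbrakk> \<Longrightarrow> f (a \<odot>\<^bsub>C\<^esub> x) = a \<odot>\<^bsub>C\<^esub> f x"
    and "\<And>x y. \<lbrakk>x \<in> carrier C; y \<in> carrier C\<rbrakk> \<Longrightarrow> f (x \<otimes>\<^bsub>C\<^esub> y) = f x \<otimes>\<^bsub>C\<^esub> y"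
    and "f \<in> extensional (carrier C)"
  shows "f \<in> multipliers R C"
  using assms by (auto simp: multipliers_def linear_maps_def)

lemma
  assumes "f \<in> multipliers R C"
  shows multiplier_closed [simp]: "x \<in> carrier C \<Longrightarrow> f x \<in> carrier C"
    and multiplier_add: "\<lbrakk>x \<in> carrier C; y \<in> carrier C\<rbrakk> \<Longrightarrow> f (x \<oplus>\<^bsub>C\<^esub> y) = f x \<oplus>\<^bsub>C\<^esub> f y"
    and multiplier_smult: "\<lbrakk>a \<in> carrier R; x \<in> carrier C\<rbrakk> \<Longrightarrow> f (a \<odot>\<^bsub>C\<^esub> x) = a \<odot>\<^bsub>C\<^esub> f x"
    and multiplier_mult: "\<lbrakk>x \<in> carrier C; y \<in> carrier C\<rbrakk> \<Longrightarrow> f (x \<otimes>\<^bsub>C\<^esub> y) = f x \<otimes>\<^bsub>C\<^esub> y"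
    and multiplier_extensional: "f \<in> extensional (carrier C)"
  using assms by (auto simp: multipliers_def linear_maps_def)

lemma multiplier_mult_right:
  "\<lbrakk>f \<in> multipliers R C; x \<in> carrier C; y \<in> carrier C\<rbrakk> \<Longrightarrow> x \<otimes>\<^bsub>C\<^esub> f y = f x \<otimes>\<^bsub>C\<^esub> y"
  by (metis mult_comm multiplier_closed multiplier_mult)

lemma multiplier_zero: "f \<in> multipliers R C \<Longrightarrow> f \<zero>\<^bsub>C\<^esub> = \<zero>\<^bsub>C\<^esub>"
  using multiplier_smult [of f "\<zero>\<^bsub>R\<^esub>" "\<zero>\<^bsub>C\<^esub>"] by simp

text \<open>Being \<open>undefined\<close> off \<open>carrier C\<close>, a multiplier is determined
  by its values there.\<close>

lemma multiplier_eqI: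
  assumes "f \<in> multipliers R C" "g \<in> multipliers R C"
    and "\<And>x. x \<in> carrier C \<Longrightarrow> f x = g x"
  shows "f = g"
  using assms by (metis extensionalityI multiplier_extensional)

text \<open>Pointwise laws such as \<open>\<zero> \<oplus> f = f\<close> reduce to this
  eta-contracted restriction.\<close>

lemma restrict_multiplier [simp]: "f \<in> multipliers R C \<Longrightarrow> restrict f (carrier C) = f"
  by (simp add: extensional_restrict multiplier_extensional)

text \<open>Used as rewrite rules, these expand products of sums and move multipliers onto the left
  factor: \<open>f (x \<otimes> y)\<close> and \<open>x \<otimes> f y\<close> both become
  \<open>f x \<otimes> y\<close>. Identities then reduce to a comparison of sorted sums.\<close>

lemmas multiplier_simps = multiplier_add multiplier_smult multiplier_zero multiplier_mult
  multiplier_mult_right mult_distr mult_rdistr smult_mult mult_smult mult_zero zero_mult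
  smult_r_distr smult_l_distr smult_assoc1 M.a_ac

declare mult_closed [simp]

section \<open>Closure properties of multipliers\<close>

lemma id_multiplier [simp]: "(\<lambda>u \<in> carrier C. u) \<in> multipliers R C"
  by (rule multipliersI) auto

lemma zero_multiplier [simp]: "(\<lambda>u \<in> carrier C. \<zero>\<^bsub>C\<^esub>) \<in> multipliers R C"
  by (rule multipliersI) (auto simp: zero_mult)

lemma add_multiplier [simp]:
  "\<lbrakk>f \<in> multipliers R C; g \<in> multipliers R C\<rbrakk>
    \<Longrightarrow> (\<lambda>u \<in> carrier C. f u \<oplus>\<^bsub>C\<^esub> g u) \<in> multipliers R C"
  by (rule multipliersI) (auto simp: multiplier_simps)

text \<open>Commutativity of \<open>R\<close> is what makes a scalar multiple of an
  \<open>R\<close>-linear map linear again.\<close>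

lemma smult_commute:
  "\<lbrakk>a \<in> carrier R; b \<in> carrier R; x \<in> carrier C\<rbrakk> \<Longrightarrow> a \<odot>\<^bsub>C\<^esub> (b \<odot>\<^bsub>C\<^esub> x) = b \<odot>\<^bsub>C\<^esub> (a \<odot>\<^bsub>C\<^esub> x)"
  by (metis R.m_comm smult_assoc1)

lemma smult_multiplier [simp]:
  "\<lbrakk>a \<in> carrier R; f \<in> multipliers R C\<rbrakk>
    \<Longrightarrow> (\<lambda>u \<in> carrier C. a \<odot>\<^bsub>C\<^esub> f u) \<in> multipliers R C"
  by (rule multipliersI) (auto simp: multiplier_simps smult_commute)

lemma compose_multiplier [simp]:
  "\<lbrakk>f \<in> multipliers R C; g \<in> multipliers R C\<rbrakk> \<Longrightarrow> compose (carrier C) f g \<in> multipliers R C"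
  by (rule multipliersI) (auto simp: compose_def multiplier_simps)

text \<open>\<open>mult_act C x f\<close> is the sum of \<open>f\<close> and multiplication by
  \<open>x\<close>; the latter is a multiplier by associativity and distributivity.\<close>

lemma mult_act_multiplier [simp]:
  "\<lbrakk>x \<in> carrier C; f \<in> multipliers R C\<rbrakk> \<Longrightarrow> mult_act C x f \<in> multipliers R C"
  by (rule multipliersI) (auto simp: mult_act_def multiplier_simps mult_assoc)

section \<open>Module structures on objects and morphisms\<close>

lemma module_multiplier_algebra: "module R (multiplier_algebra R C)"
proof (rule moduleI)
  show "cring R" by (rule R.is_cring)
  show "abelian_group (multiplier_algebra R C)"
  proof (rule abelian_groupI)
    fix f assume f: "f \<in> carrier (multiplier_algebra R C)"
    show "\<exists>g \<in> carrier (multiplier_algebra R C).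
      g \<oplus>\<^bsub>multiplier_algebra R C\<^esub> f = \<zero>\<^bsub>multiplier_algebra R C\<^esub>"
    proof (rule bexI)
      \<comment> \<open>The negative of \<open>f\<close> is taken as a scalar multiple by minus one,
        so that closure under scalars shows it to be a multiplier.\<close>
      show "(\<lambda>u \<in> carrier C. (\<ominus>\<^bsub>R\<^esub> \<one>\<^bsub>R\<^esub>) \<odot>\<^bsub>C\<^esub> f u) \<in> carrier (multiplier_algebra R C)"
        using f by simp
      show "(\<lambda>u \<in> carrier C. (\<ominus>\<^bsub>R\<^esub> \<one>\<^bsub>R\<^esub>) \<odot>\<^bsub>C\<^esub> f u) \<oplus>\<^bsub>multiplier_algebra R C\<^esub> f
          = \<zero>\<^bsub>multiplier_algebra R C\<^esub>"
        using f by (auto simp: smult_l_minus M.l_neg intro!: restrict_ext)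
    qed
  qed (auto simp: multiplier_simps cong: restrict_cong)
qed (auto simp: multiplier_simps cong: restrict_cong)

lemma module_semidirect_multiplier: "module R (semidirect_multiplier R C)"
proof -
  interpret MC: module R "multiplier_algebra R C" by (rule module_multiplier_algebra)
  show ?thesis
  proof (rule moduleI)
    show "cring R" by (rule R.is_cring)
    show "abelian_group (semidirect_multiplier R C)"
    proof (rule abelian_groupI)
      fix p assume "p \<in> carrier (semidirect_multiplier R C)"
      then obtain x f where p: "p = (x, f)" and x: "x \<in> carrier C" and f: "f \<in> multipliers R C"
        by auto
      show "\<exists>q \<in> carrier (semidirect_multiplier R C).
        q \<oplus>\<^bsub>semidirect_multiplier R C\<^esub> p = \<zero>\<^bsub>semidirect_multiplier R C\<^esub>"
      proof (rule bexI)
        show "(\<ominus>\<^bsub>C\<^esub> x, \<ominus>\<^bsub>multiplier_algebra R C\<^esub> f) \<in> carrier (semidirect_multiplier R C)"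
          using x f MC.a_inv_closed [of f] by simp
        show "(\<ominus>\<^bsub>C\<^esub> x, \<ominus>\<^bsub>multiplier_algebra R C\<^esub> f) \<oplus>\<^bsub>semidirect_multiplier R C\<^esub> p
            = \<zero>\<^bsub>semidirect_multiplier R C\<^esub>"
          using x f MC.l_neg [of f] by (simp add: p M.l_neg)
      qed
    qed (auto simp: multiplier_simps cong: restrict_cong)
  qed (auto simp: multiplier_simps cong: restrict_cong)
qed

section \<open>Commuting multipliers\<close>

lemma multipliers_commute_on_products:
  assumes "f \<in> multipliers R C" "g \<in> multipliers R C" "x \<in> carrier C" "y \<in> carrier C"
  shows "f (g (x \<otimes>\<^bsub>C\<^esub> y)) = g (f (x \<otimes>\<^bsub>C\<^esub> y))"
proof -
  \<comment> \<open>Once \<open>g\<close> has been absorbed by \<open>x\<close>, swapping the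
    factors lets \<open>f\<close> act on \<open>y\<close> instead of on \<open>g x\<close>.\<close>
  have "f (g (x \<otimes>\<^bsub>C\<^esub> y)) = f (y \<otimes>\<^bsub>C\<^esub> g x)"
    using assms by (simp add: multiplier_mult mult_comm)
  also have "\<dots> = g x \<otimes>\<^bsub>C\<^esub> f y"
    using assms by (simp add: multiplier_mult mult_comm)
  also have "\<dots> = g (x \<otimes>\<^bsub>C\<^esub> f y)"
    using assms by (simp add: multiplier_mult)
  also have "x \<otimes>\<^bsub>C\<^esub> f y = f (x \<otimes>\<^bsub>C\<^esub> y)"
    using assms by (simp only: multiplier_mult multiplier_mult_right)
  finally show ?thesis .
qed

text \<open>Multiplying the commutator's value at \<open>x\<close> by \<open>y\<close> gives its
  value at the product of \<open>x\<close> and \<open>y\<close>, which vanishes. The value at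
  \<open>x\<close> therefore lies in \<open>Ann C\<close>.\<close>

lemma multipliers_commute_if_Ann_zero:
  assumes "Ann C = {\<zero>\<^bsub>C\<^esub>}" and f: "f \<in> multipliers R C" and g: "g \<in> multipliers R C"
    and x: "x \<in> carrier C"
  shows "f (g x) = g (f x)"
proof -
  define d where "d = f (g x) \<ominus>\<^bsub>C\<^esub> g (f x)"
  \<comment> \<open>The difference is recorded as a sum, so that the distributive law for sums
    applies directly and the common term can be cancelled.\<close>
  have d: "d \<in> carrier C" "d \<oplus>\<^bsub>C\<^esub> g (f x) = f (g x)"
    using f g x by (simp_all add: d_def M.minus_eq M.a_assoc M.l_neg)
  have "d \<otimes>\<^bsub>C\<^esub> y = \<zero>\<^bsub>C\<^esub>" if y: "y \<in> carrier C" for y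
  proof -
    have "d \<otimes>\<^bsub>C\<^esub> y \<oplus>\<^bsub>C\<^esub> g (f x) \<otimes>\<^bsub>C\<^esub> y = f (g x) \<otimes>\<^bsub>C\<^esub> y"
      using d f g x y by (simp flip: mult_distr)
    also have "\<dots> = g (f x) \<otimes>\<^bsub>C\<^esub> y"
      using multipliers_commute_on_products [OF f g x y] f g x y by (simp add: multiplier_mult)
    finally show ?thesis
      using d(1) f g x y by (simp add: M.add.r_cancel_one)
  qed
  then have "d = \<zero>\<^bsub>C\<^esub>"
    using assms(1) d(1) by (auto simp: Ann_def)
  then show ?thesis
    using d(2) f g x by simp
qed

text \<open>The equalizer of the two composites is a submodule containing every product. It is thus
  one of the ideals whose intersection defines \<open>ideal_square R C\<close>.\<close>

lemma multipliers_commute_if_square: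
  assumes "ideal_square R C = carrier C" and f: "f \<in> multipliers R C" and g: "g \<in> multipliers R C"
    and x: "x \<in> carrier C"
  shows "f (g x) = g (f x)"
proof -
  let ?I = "{c \<in> carrier C. f (g c) = g (f c)}"
  \<comment> \<open>Closure of \<open>?I\<close> under negatives is reduced to compatibility of
    \<open>f\<close> and \<open>g\<close> with scalars.\<close>
  have neg: "\<ominus>\<^bsub>C\<^esub> c = (\<ominus>\<^bsub>R\<^esub> \<one>\<^bsub>R\<^esub>) \<odot>\<^bsub>C\<^esub> c" if "c \<in> carrier C" for c
    using that by (simp add: smult_l_minus)
  have "submodule ?I R C"
    by (rule submoduleI) (use f g in \<open>auto simp: multiplier_simps neg\<close>)
  then have "algebra_ideal ?I R C"
    using f g by (auto simp: algebra_ideal_def multipliers_commute_on_products)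
  then have "ideal_square R C \<subseteq> ?I"
    using f g by (auto simp: ideal_square_def multipliers_commute_on_products)
  then show ?thesis using assms(1) x by blast
qed

section \<open>The 2-algebra over \<open>R\<close>\<close>

lemma mult_act_eq: "u \<in> carrier C \<Longrightarrow> mult_act C x f u = x \<otimes>\<^bsub>C\<^esub> u \<oplus>\<^bsub>C\<^esub> f u"
  by (simp add: mult_act_def)

text \<open>Actions add up by distributivity; this is the target axiom for a vertical
  composite.\<close>

lemma mult_act_mult_act:
  "\<lbrakk>x \<in> carrier C; y \<in> carrier C; f \<in> multipliers R C\<rbrakk>
    \<Longrightarrow> mult_act C y (mult_act C x f) = mult_act C (y \<oplus>\<^bsub>C\<^esub> x) f"
  by (auto simp: mult_act_def multiplier_simps intro!: restrict_ext)

text \<open>Commutation is a hypothesis here, so that both alternatives on \<open>C\<close> lead to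
  the same verification. The product on morphisms is that of
  \<open>semidirect_multiplier R C\<close>, up to the order of the summands and of the factors in
  \<open>C\<close>.\<close>

lemma two_algebra_multipliers:
  assumes comm: "\<And>f g x. \<lbrakk>f \<in> multipliers R C; g \<in> multipliers R C; x \<in> carrier C\<rbrakk>
    \<Longrightarrow> f (g x) = g (f x)"
  shows "two_algebra R (multiplier_algebra R C) (semidirect_multiplier R C)
    (\<lambda>(x, f). f)
    (\<lambda>(x, f). mult_act C x f)
    (\<lambda>f. (\<zero>\<^bsub>C\<^esub>, f))
    (\<lambda>((x, f), (x', g)). (x' \<oplus>\<^bsub>C\<^esub> x, f))
    (\<lambda>f f'. compose (carrier C) f f')
    (\<lambda>(x, f) (y, f'). (f' x \<oplus>\<^bsub>C\<^esub> f y \<oplus>\<^bsub>C\<^esub> x \<otimes>\<^bsub>C\<^esub> y, compose (carrier C) f' f))"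
proof -
  interpret A0: module R "multiplier_algebra R C" by (rule module_multiplier_algebra)
  interpret A1: module R "semidirect_multiplier R C" by (rule module_semidirect_multiplier)
  have comp_comm: "compose (carrier C) f g = compose (carrier C) g f"
    if "f \<in> multipliers R C" "g \<in> multipliers R C" for f g
    using that comm by (auto simp: compose_def intro!: restrict_ext)
  show ?thesis
    apply unfold_locales
    subgoal by (auto simp: linear_maps_def)
    subgoal by (auto simp: linear_maps_def multiplier_simps mult_act_eq intro!: multiplier_eqI)
    subgoal by (auto simp: linear_maps_def)
    subgoal by (auto simp: linear_maps_def composable_pairs_def module_prod_def multiplier_simps)
    subgoal by auto
    subgoal by (auto simp: mult_act_def zero_mult cong: restrict_cong)
    subgoal by auto
    subgoal by (auto simp: mult_act_mult_act)
    subgoal by (auto simp: M.a_ac)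
    subgoal by auto
    subgoal by auto
    subgoal
      by (auto simp: bilinear_op_def linear_maps_def multiplier_simps compose_eq
          intro!: multiplier_eqI)
    subgoal
      by (auto simp: bilinear_op_def linear_maps_def multiplier_simps compose_eq
          intro!: multiplier_eqI)
    \<comment> \<open>The product on morphisms composes multipliers in the order opposite to the
      product on objects, so the source axiom rests on \<open>comp_comm\<close>.\<close>
    subgoal by (auto intro: comp_comm)
    \<comment> \<open>Target axiom: composing the targets of \<open>(x, f)\<close> and
      \<open>(y, f')\<close> and evaluating at \<open>u\<close> yields the cross terms
      \<open>x \<otimes> f' u\<close> and \<open>f (y \<otimes> u)\<close>, which become
      \<open>f' x \<otimes> u\<close> and \<open>f y \<otimes> u\<close>.\<close>
    subgoal
      by (auto simp: compose_eq mult_act_eq multiplier_simps mult_assoc comm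
          intro!: multiplier_eqI)
    subgoal by (auto simp: multiplier_simps comp_comm)
    \<comment> \<open>Interchange: composability forces the multipliers of the second pair to be
      \<open>mult_act C x f\<close> and \<open>mult_act C y g\<close>, where \<open>(x, f)\<close>
      and \<open>(y, g)\<close> are the first pair. Evaluating them supplies the mixed products in
      the expansion of \<open>(x' \<oplus> x) \<otimes> (y' \<oplus> y)\<close>.\<close>
    subgoal by (auto simp: mult_act_eq multiplier_simps mult_comm)
    subgoal by (auto simp: compose_eq intro!: multiplier_eqI)
    \<comment> \<open>The two bracketings apply pairs of multipliers to the last two
      \<open>C\<close>-components in different orders; \<open>comm\<close> identifies them.\<close>
    subgoal by (auto simp: compose_eq multiplier_simps mult_assoc comm intro!: multiplier_eqI)
    subgoal by (auto intro: comp_comm)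
    subgoal by (auto simp: M.a_ac mult_comm intro: comp_comm)
    subgoal by (rule bexI [where x = "\<lambda>u \<in> carrier C. u"])
        (auto simp: multiplier_simps compose_eq intro!: multiplier_eqI)
    done
qed

end

theorem mainTheorem4:
  fixes k :: "('k, 'i) ring_scheme"
    and R :: "('k, 'r, 'm) module_scheme"
    and C :: "('r, 'c, 'n) module_scheme"
  assumes "cring k"
    and "algebra k R"
    and "comm_nonunital_algebra R C"
    and "Ann C = {\<zero>\<^bsub>C\<^esub>} \<or> ideal_square R C = carrier C"
  shows "two_algebra k
    (restrict_scalars R (multiplier_algebra R C))
    (restrict_scalars R (semidirect_multiplier R C))
    (\<lambda>(x, f). f)
    (\<lambda>(x, f). mult_act C x f)
    (\<lambda>f. (\<zero>\<^bsub>C\<^esub>, f))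
    (\<lambda>((x, f), (x', g)). (x' \<oplus>\<^bsub>C\<^esub> x, f))
    (\<lambda>f f'. compose (carrier C) f f')
    (\<lambda>(x, f) (y, f'). (f' x \<oplus>\<^bsub>C\<^esub> f y \<oplus>\<^bsub>C\<^esub> x \<otimes>\<^bsub>C\<^esub> y, compose (carrier C) f' f))"
proof -
  interpret C: comm_nonunital_algebra R C by fact
  have "f (g x) = g (f x)"
    if "f \<in> multipliers R C" "g \<in> multipliers R C" "x \<in> carrier C" for f g x
    using assms(4) that C.multipliers_commute_if_Ann_zero C.multipliers_commute_if_square by blast
  then show ?thesis
    by (intro two_algebra_restrict_scalars C.two_algebra_multipliers assms(2))
qed

end
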